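(* Let $X$ be a real normed space and let $p:X\to\mathbb{R}$ be a real-valued positively homogeneous function. (i) $p$ is upper semicontinuous on $X$ if and only if $S^+_C(p)\neq\varnothing$ and $$p(x)=\inf_{\varphi\in S^+_C(p)}\varphi(x)\quad\text{for all } x\in X.$$ (ii) $p$ is lower semicontinuous on $X$ if and only if $S^-_C(p)\neq\varnothing$ and $$p(x)=\sup_{\psi\in S^-_C(p)}\psi(x)\quad\text{for all } x\in X.$$
   Context: $\overline{\mathbb{R}}=\mathbb{R}\cup\{\pm\infty\}$. A function $p$ is positively homogeneous if $p(\lambda x)=\lambda p(x)$ for all $x\in X$ and all $\lambda>0$. A function $g:X\to\overline{\mathbb{R}}$ is convex if $g(x)>-\infty$ for all $x\in X$ and its epigraph $\{(x,\alpha)\in X\times\mathbb{R}: g(x)\le\alpha\}$ is a nonempty convex set; $h$ is concave if $-h$ is convex. Sublinear means convex and positively homogeneous; superlinear means concave and positively homogeneous. A minimal convex majorant of $p$ is a convex function $g:X\to\overline{\mathbb{R}}$ with $p\le g$ pointwise on $X$ that is minimal (for the pointwise ordering) among all such convex functions. A maximal concave minorant of $p$ is a concave function $h:X\to\overline{\mathbb{R}}$ with $h\le p$ pointwise on $X$ that is maximal (for the pointwise ordering) among all such concave functions. Minimal convex majorants (respectively maximal concave minorants) of a real-valued positively homogeneous function are sublinear (respectively superlinear). $S^+_C(p)$ is the set of all minimal convex majorants of $p$ that are real-valued continuous sublinear functions on $X$ (equivalently, those that are Lipschitz continuous on $X$); $S^-_C(p)$ is the set of all maximal concave minorants of $p$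 that are real-valued continuous superlinear functions on $X$. *)

theory Defs
  imports "HOL-Analysis.Analysis"
begin

definition pos_homogeneous :: "('a::real_vector \<Rightarrow> ereal) \<Rightarrow> bool" where
  "pos_homogeneous g \<longleftrightarrow> (\<forall>x. \<forall>t::real. t > 0 \<longrightarrow> g (t *\<^sub>R x) = ereal t * g x)"

(* The heights range over the reals only, even though g is extended real-valued; the library's
   epigraph and convex_on cover real-valued functions only. *)
definition ereal_epigraph :: "('a \<Rightarrow> ereal) \<Rightarrow> ('a \<times> real) set" where
  "ereal_epigraph g = {(x, \<alpha>). g x \<le> ereal \<alpha>}"

definition ereal_convex :: "('a::real_vector \<Rightarrow> ereal) \<Rightarrow> bool" where
  "ereal_convex g \<longleftrightarrow>
     (\<forall>x. g x > -\<infinity>) \<and> ereal_epigraph g \<noteq> {} \<and> convex (ereal_epigraph g)"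

definition ereal_concave :: "('a::real_vector \<Rightarrow> ereal) \<Rightarrow> bool" where
  "ereal_concave h \<longleftrightarrow> ereal_convex (\<lambda>x. - h x)"

definition sublinear :: "('a::real_vector \<Rightarrow> ereal) \<Rightarrow> bool" where
  "sublinear g \<longleftrightarrow> ereal_convex g \<and> pos_homogeneous g"

definition superlinear :: "('a::real_vector \<Rightarrow> ereal) \<Rightarrow> bool" where
  "superlinear h \<longleftrightarrow> ereal_concave h \<and> pos_homogeneous h"

definition convex_majorant :: "('a::real_vector \<Rightarrow> ereal) \<Rightarrow> ('a \<Rightarrow> ereal) \<Rightarrow> bool" where
  "convex_majorant p g \<longleftrightarrow> ereal_convex g \<and> (\<forall>x. p x \<le> g x)"

definition concave_minorant :: "('a::real_vector \<Rightarrow> ereal) \<Rightarrow> ('a \<Rightarrow> ereal) \<Rightarrow> bool" where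
  "concave_minorant p h \<longleftrightarrow> ereal_concave h \<and> (\<forall>x. h x \<le> p x)"

definition minimal_convex_majorant :: "('a::real_vector \<Rightarrow> ereal) \<Rightarrow> ('a \<Rightarrow> ereal) \<Rightarrow> bool" where
  "minimal_convex_majorant p g \<longleftrightarrow>
     convex_majorant p g \<and> (\<forall>g'. convex_majorant p g' \<and> (\<forall>x. g' x \<le> g x) \<longrightarrow> g' = g)"

definition maximal_concave_minorant :: "('a::real_vector \<Rightarrow> ereal) \<Rightarrow> ('a \<Rightarrow> ereal) \<Rightarrow> bool" where
  "maximal_concave_minorant p h \<longleftrightarrow>
     concave_minorant p h \<and> (\<forall>h'. concave_minorant p h' \<and> (\<forall>x. h x \<le> h' x) \<longrightarrow> h' = h)"

(* The members are real-valued functions, but minimality and maximality are taken among all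
   extended real-valued convex majorants and concave minorants. *)
definition S_C_plus :: "('a::real_normed_vector \<Rightarrow> ereal) \<Rightarrow> ('a \<Rightarrow> real) set" where
  "S_C_plus p = {\<phi>. minimal_convex_majorant p (\<lambda>x. ereal (\<phi> x)) \<and>
                     sublinear (\<lambda>x. ereal (\<phi> x)) \<and> continuous_on UNIV \<phi>}"

definition S_C_minus :: "('a::real_normed_vector \<Rightarrow> ereal) \<Rightarrow> ('a \<Rightarrow> real) set" where
  "S_C_minus p = {\<psi>. maximal_concave_minorant p (\<lambda>x. ereal (\<psi> x)) \<and>
                      superlinear (\<lambda>x. ereal (\<psi> x)) \<and> continuous_on UNIV \<psi>}"

definition upper_semicontinuous :: "('a::topological_space \<Rightarrow> 'b::linorder) \<Rightarrow> bool" where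
  "upper_semicontinuous f \<longleftrightarrow> (\<forall>x c. f x < c \<longrightarrow> (\<forall>\<^sub>F y in nhds x. f y < c))"

definition lower_semicontinuous :: "('a::topological_space \<Rightarrow> 'b::linorder) \<Rightarrow> bool" where
  "lower_semicontinuous f \<longleftrightarrow> (\<forall>x c. c < f x \<longrightarrow> (\<forall>\<^sub>F y in nhds x. c < f y))"

end

theory Submission
  imports Defs
begin

text \<open>
  For part (i), upper semicontinuity at 0 and homogeneity give \<open>p x \<le> K * norm x\<close>; together
  with upper semicontinuity at \<open>x0\<close> this yields, for every \<open>c > p x0\<close>, a constant \<open>M\<close> with
  \<open>p y \<le> c + M * norm (y - x0)\<close> for all \<open>y\<close>. By homogeneity the infimal convolution
  \<open>\<phi> x = (INF t\<in>{0..}. t * c + M * norm (x - t *\<^sub>R x0))\<close> is then a sublinear majorant of \<open>p\<close>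
  with \<open>\<phi> x0 \<le> c\<close> and \<open>\<phi> x \<le> M * norm x\<close>. Zorn's lemma gives a minimal sublinear majorant
  below \<open>\<phi>\<close>; the bound by \<open>M * norm x\<close> makes it Lipschitz, and it is minimal among all convex
  majorants because the sublinear hull \<open>INF t\<in>{0<..}. g (t *\<^sub>R x) / t\<close> of a convex majorant \<open>g\<close>
  is again a majorant of \<open>p\<close>. Part (ii) is part (i) for \<open>- p\<close>.
\<close>

section \<open>Real-valued sublinear functions\<close>

text \<open>A real-valued form of \<open>sublinear\<close>, with subadditivity in place of a convex
  epigraph: pointwise inequalities pass more easily to the infima formed below.\<close>

definition sublinear_fun :: "('a::real_vector \<Rightarrow> real) \<Rightarrow> bool" where
  "sublinear_fun q \<longleftrightarrow>
     (\<forall>x y. q (x + y) \<le> q x + q y) \<and> (\<forall>x t. t > 0 \<longrightarrow> q (t *\<^sub>R x) = t * q x)"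

text \<open>The inequality for \<open>inverse t\<close> at the point \<open>t *\<^sub>R x\<close> is
  the reverse inequality for \<open>t\<close>, so functions defined as infima need only one half of
  homogeneity checked.\<close>

lemma sublinear_funI:
  assumes "\<And>x y. q (x + y) \<le> q x + q y"
    and le: "\<And>x t. t > 0 \<Longrightarrow> q (t *\<^sub>R x) \<le> t * q x"
  shows "sublinear_fun q"
proof -
  have "t * q x \<le> q (t *\<^sub>R x)" if "t > 0" for x t
    using le[of "inverse t" "t *\<^sub>R x"] that by (simp add: field_simps)
  then show ?thesis
    using assms by (force simp: sublinear_fun_def intro: antisym)
qed

lemma sublinear_fun_add: "sublinear_fun q \<Longrightarrow> q (x + y) \<le> q x + q y"
  and sublinear_fun_scaleR: "sublinear_fun q \<Longrightarrow> t > 0 \<Longrightarrow> q (t *\<^sub>R x) = t * q x"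
  by (auto simp: sublinear_fun_def)

text \<open>Bridge to the library: for a real-valued function both epigraphs coincide, and the graph
  makes them nonempty.\<close>

lemma ereal_convex_real_iff:
  fixes q :: "'a::real_vector \<Rightarrow> real"
  shows "ereal_convex (\<lambda>x. ereal (q x)) \<longleftrightarrow> convex_on UNIV q"
proof -
  have "ereal_epigraph (\<lambda>x. ereal (q x)) = epigraph UNIV q"
    by (auto simp: ereal_epigraph_def epigraph_def)
  moreover have "(undefined, q undefined) \<in> epigraph UNIV q"
    by (simp add: epigraph_def)
  ultimately show ?thesis
    by (auto simp: ereal_convex_def convex_epigraph)
qed

lemma pos_homogeneous_real_iff:
  fixes q :: "'a::real_vector \<Rightarrow> real"
  shows "pos_homogeneous (\<lambda>x. ereal (q x)) \<longleftrightarrow> (\<forall>x t. t > 0 \<longrightarrow> q (t *\<^sub>R x) = t * q x)"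
  by (simp add: pos_homogeneous_def)

lemma sublinear_fun_imp_convex_on:
  assumes "sublinear_fun q"
  shows "convex_on UNIV q"
proof (rule convex_onI)
  fix t :: real and x y
  assume "0 < t" "t < 1"
  then show "q ((1 - t) *\<^sub>R x + t *\<^sub>R y) \<le> (1 - t) * q x + t * q y"
    using sublinear_fun_add[OF assms, of "(1 - t) *\<^sub>R x" "t *\<^sub>R y"]
      sublinear_fun_scaleR[OF assms, of "1 - t" x] sublinear_fun_scaleR[OF assms, of t y]
    by simp
qed simp

lemma sublinear_fun_imp_sublinear:
  "sublinear_fun q \<Longrightarrow> sublinear (\<lambda>x. ereal (q x))"
  by (simp add: sublinear_def ereal_convex_real_iff pos_homogeneous_real_iff
      sublinear_fun_imp_convex_on sublinear_fun_scaleR)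

text \<open>A one-sided bound suffices: subadditivity gives
  \<open>q x - q y \<le> q (x - y)\<close>, and exchanging \<open>x\<close> and \<open>y\<close>
  turns this into a Lipschitz estimate.\<close>

lemma sublinear_fun_continuous_on:
  fixes q :: "'a::real_normed_vector \<Rightarrow> real"
  assumes "sublinear_fun q" and bound: "\<And>x. q x \<le> M * norm x"
  shows "continuous_on UNIV q"
proof -
  have *: "q x - q y \<le> \<bar>M\<bar> * norm (x - y)" for x y
    using sublinear_fun_add[OF assms(1), of y "x - y"] bound[of "x - y"]
      mult_right_mono[OF abs_ge_self[of M] norm_ge_zero[of "x - y"]] by simp
  have "\<bar>M\<bar>-lipschitz_on UNIV q"
  proof (rule lipschitz_onI)
    show "dist (q x) (q y) \<le> \<bar>M\<bar> * dist x y" for x y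
      using *[of x y] *[of y x] by (auto simp: dist_norm norm_minus_commute abs_le_iff)
  qed simp
  then show ?thesis
    by (rule lipschitz_on_continuous_on)
qed

section \<open>Sublinear hull of a convex majorant\<close>

text \<open>Homogeneity of \<open>p\<close> makes \<open>p x\<close> a lower bound of every quotient
  \<open>r (t *\<^sub>R x) / t\<close>, so their infimum is finite and still majorizes
  \<open>p\<close>.\<close>

lemma sublinear_hull:
  fixes r :: "'a::real_vector \<Rightarrow> real"
  assumes conv: "convex_on UNIV r"
    and hom: "\<And>x t. t > 0 \<Longrightarrow> p (t *\<^sub>R x) = t * p x"
    and major: "\<And>x. p x \<le> r x"
  obtains h where "sublinear_fun h" "\<And>x. p x \<le> h x" "\<And>x. h x \<le> r x"
proof
  define h where "h = (\<lambda>x. INF t\<in>{0<..}. r (t *\<^sub>R x) / t)"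
  have ge: "p x \<le> r (t *\<^sub>R x) / t" if "t > 0" for x t
    using major[of "t *\<^sub>R x"] hom[OF that, of x] that by (simp add: field_simps)
  have bdd: "bdd_below ((\<lambda>t. r (t *\<^sub>R x) / t) ` {0<..})" for x
    using ge by (auto intro!: bdd_belowI2[where m = "p x"])
  have h_le: "h x \<le> r (t *\<^sub>R x) / t" if "t > 0" for x t
    unfolding h_def using that by (intro cINF_lower bdd) auto
  have h_ge: "z \<le> h x" if "\<And>t. t > 0 \<Longrightarrow> z \<le> r (t *\<^sub>R x) / t" for z x
    unfolding h_def using that by (intro cINF_greatest) (auto intro: exI[of _ 1])
  show "p x \<le> h x" for x
    using ge by (rule h_ge)
  show "h x \<le> r x" for x
    using h_le[of 1 x] by simp
  show "sublinear_fun h"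
  proof (rule sublinear_funI)
    fix x y
    have *: "h (x + y) \<le> r (s *\<^sub>R x) / s + r (t *\<^sub>R y) / t" if "s > 0" "t > 0" for s t
    proof -
      \<comment> \<open>The weights \<open>t / (s + t)\<close> and \<open>s / (s + t)\<close> give
        both points \<open>s *\<^sub>R x\<close> and \<open>t *\<^sub>R y\<close> the same factor
        \<open>u\<close>, so their convex combination is a multiple of \<open>x + y\<close>.\<close>
      define u where "u = s * t / (s + t)"
      have u: "u > 0" using that by (simp add: u_def)
      have "r ((t / (s + t)) *\<^sub>R (s *\<^sub>R x) + (s / (s + t)) *\<^sub>R (t *\<^sub>R y))
          \<le> t / (s + t) * r (s *\<^sub>R x) + s / (s + t) * r (t *\<^sub>R y)"
      proof -
        have "t / (s + t) + s / (s + t) = 1"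
          using that by (simp add: add_divide_distrib[symmetric])
        then show ?thesis
          using conv that unfolding convex_on_def
          by (auto simp del: scaleR_scaleR times_divide_eq_left)
      qed
      also have "(t / (s + t)) *\<^sub>R (s *\<^sub>R x) + (s / (s + t)) *\<^sub>R (t *\<^sub>R y) = u *\<^sub>R (x + y)"
        by (simp add: u_def scaleR_right_distrib mult.commute)
      also have "t / (s + t) * r (s *\<^sub>R x) + s / (s + t) * r (t *\<^sub>R y)
          = u * (r (s *\<^sub>R x) / s + r (t *\<^sub>R y) / t)"
        using that by (simp add: u_def distrib_left)
      finally have "r (u *\<^sub>R (x + y)) / u \<le> r (s *\<^sub>R x) / s + r (t *\<^sub>R y) / t"
        using u by (simp add: field_simps)
      with h_le[OF u, of "x + y"] show ?thesis by linarith
    qed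
    \<comment> \<open>The infimum is taken over the second parameter with \<open>s\<close> fixed,
      and then over \<open>s\<close>.\<close>
    have "h (x + y) - r (s *\<^sub>R x) / s \<le> h y" if "s > 0" for s
      using *[OF that] by (intro h_ge) (simp add: algebra_simps)
    then have "h (x + y) - h y \<le> h x"
      by (intro h_ge) (smt (verit))
    then show "h (x + y) \<le> h x + h y" by simp
  next
    fix x and t :: real
    assume t: "t > 0"
    have "h (t *\<^sub>R x) / t \<le> h x"
    proof (rule h_ge)
      fix s :: real assume "s > 0"
      then show "h (t *\<^sub>R x) / t \<le> r (s *\<^sub>R x) / s"
        using h_le[of "s / t" "t *\<^sub>R x"] t by (simp add: field_simps)
    qed
    then show "h (t *\<^sub>R x) \<le> t * h x"
      using t by (simp add: field_simps)
  qed
qed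

section \<open>Minimal majorants by Zorn's lemma\<close>

text \<open>Infima of sublinear functions need not be subadditive. In a chain they are: the smaller
  of \<open>q\<close> and \<open>q'\<close>, evaluated at \<open>x + y\<close>, is bounded by
  \<open>q x + q' y\<close>.\<close>

lemma sublinear_fun_INF_chain:
  assumes "C \<noteq> {}" and sub: "\<And>q. q \<in> C \<Longrightarrow> sublinear_fun q"
    and chain: "\<And>q q'. q \<in> C \<Longrightarrow> q' \<in> C \<Longrightarrow> q \<le> q' \<or> q' \<le> q"
    and bdd: "\<And>x. bdd_below ((\<lambda>q. q x) ` C)"
  shows "sublinear_fun (\<lambda>x. INF q\<in>C. q x)"
proof (rule sublinear_funI)
  let ?u = "\<lambda>x. INF q\<in>C. q x"
  have le: "?u x \<le> q x" if "q \<in> C" for q x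
    using bdd that by (intro cINF_lower)
  show "?u (x + y) \<le> ?u x + ?u y" for x y
  proof -
    have *: "?u (x + y) \<le> q x + q' y" if "q \<in> C" "q' \<in> C" for q q'
      using chain[OF that]
    proof
      assume "q \<le> q'"
      then show ?thesis
        using le[OF that(1), of "x + y"] sublinear_fun_add[OF sub[OF that(1)], of x y]
        by (auto dest: le_funD[of _ _ y])
    next
      assume "q' \<le> q"
      then show ?thesis
        using le[OF that(2), of "x + y"] sublinear_fun_add[OF sub[OF that(2)], of x y]
        by (auto dest: le_funD[of _ _ x])
    qed
    have "?u (x + y) - q x \<le> ?u y" if "q \<in> C" for q
      using *[OF that] by (intro cINF_greatest assms(1)) (simp add: algebra_simps)
    then have "?u (x + y) - ?u y \<le> ?u x"
      by (intro cINF_greatest assms(1)) (smt (verit))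
    then show ?thesis by simp
  qed
  show "?u (t *\<^sub>R x) \<le> t * ?u x" if t: "t > 0" for t x
  proof -
    have "?u (t *\<^sub>R x) / t \<le> ?u x"
      using le[of _ "t *\<^sub>R x"] sublinear_fun_scaleR[OF sub t] t
      by (intro cINF_greatest assms(1)) (simp add: field_simps)
    then show ?thesis
      using t by (simp add: field_simps)
  qed
qed

lemma minimal_sublinear_majorant:
  fixes p :: "'a::real_vector \<Rightarrow> real"
  assumes "sublinear_fun \<phi>" "p \<le> \<phi>"
  obtains q where "sublinear_fun q" "p \<le> q" "q \<le> \<phi>"
    "\<And>q'. sublinear_fun q' \<Longrightarrow> p \<le> q' \<Longrightarrow> q' \<le> q \<Longrightarrow> q' = q"
proof -
  define A where "A = {q. sublinear_fun q \<and> p \<le> q \<and> q \<le> \<phi>}"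
  \<comment> \<open>The order is reversed, so that a maximal element in Zorn's lemma is a minimal
    majorant.\<close>
  let ?P = "\<lambda>q q' :: 'a \<Rightarrow> real. q' \<le> q"
  have "\<exists>m\<in>A. \<forall>q\<in>A. ?P m q \<longrightarrow> q = m"
  proof (rule predicate_Zorn)
    show "partial_order_on A (relation_of ?P A)"
      by (rule partial_order_on_relation_ofI) auto
    fix C
    assume "C \<in> Chains (relation_of ?P A)"
    then have CA: "C \<subseteq> A" and chain: "\<And>q q'. q \<in> C \<Longrightarrow> q' \<in> C \<Longrightarrow> q \<le> q' \<or> q' \<le> q"
      by (auto simp: Chains_def relation_of_def)
    show "\<exists>u\<in>A. \<forall>q\<in>C. u \<le> q"
    proof (cases "C = {}")
      case True
      then show ?thesis using assms by (auto simp: A_def)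
    next
      case False
      let ?u = "\<lambda>x. INF q\<in>C. q x"
      have bdd: "bdd_below ((\<lambda>q. q x) ` C)" for x
        using CA by (auto intro!: bdd_belowI2[where m = "p x"] simp: A_def le_fun_def)
      have "sublinear_fun ?u"
        using CA by (intro sublinear_fun_INF_chain False chain bdd) (auto simp: A_def)
      moreover have "p \<le> ?u"
        using CA False by (auto simp: A_def le_fun_def intro!: cINF_greatest)
      moreover have u_le: "?u \<le> q" if "q \<in> C" for q
        using bdd that by (auto simp: le_fun_def intro: cINF_lower)
      moreover have "?u \<le> \<phi>"
        using False CA u_le by (force simp: A_def intro: order_trans)
      ultimately show ?thesis by (auto simp: A_def)
    qed
  qed
  \<comment> \<open>Minimality within \<open>A\<close> is minimality among all sublinear majorants,
    since a competitor below \<open>q\<close> is also below \<open>\<phi>\<close> and hence in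
    \<open>A\<close>.\<close>
  then show ?thesis
    using that by (auto simp: A_def intro: order_trans)
qed

text \<open>A convex majorant \<open>g\<close> below \<open>q\<close> has a sublinear hull between
  \<open>p\<close> and \<open>g\<close>. Minimality makes this hull equal to \<open>q\<close>, which
  squeezes \<open>g\<close> onto \<open>q\<close>.\<close>

lemma minimal_convex_majorant_if_minimal_sublinear:
  fixes p q :: "'a::real_vector \<Rightarrow> real"
  assumes hom: "\<And>x t. t > 0 \<Longrightarrow> p (t *\<^sub>R x) = t * p x"
    and q: "sublinear_fun q" "p \<le> q"
    and min: "\<And>q'. sublinear_fun q' \<Longrightarrow> p \<le> q' \<Longrightarrow> q' \<le> q \<Longrightarrow> q' = q"
  shows "minimal_convex_majorant (\<lambda>x. ereal (p x)) (\<lambda>x. ereal (q x))"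
  unfolding minimal_convex_majorant_def
proof (intro conjI allI impI; (elim conjE)?)
  show "convex_majorant (\<lambda>x. ereal (p x)) (\<lambda>x. ereal (q x))"
    using q by (simp add: convex_majorant_def ereal_convex_real_iff sublinear_fun_imp_convex_on
        le_fun_def)
  fix g
  assume g: "convex_majorant (\<lambda>x. ereal (p x)) g" "\<forall>x. g x \<le> ereal (q x)"
  \<comment> \<open>Lying between the finite values of \<open>p\<close> and \<open>q\<close>, the
    competitor \<open>g\<close> is itself finite, so real-valued convexity applies.\<close>
  define r where "r = (\<lambda>x. real_of_ereal (g x))"
  have g_eq: "g = (\<lambda>x. ereal (r x))"
  proof
    fix x
    have "ereal (p x) \<le> g x" "g x \<le> ereal (q x)"
      using g by (auto simp: convex_majorant_def)
    then show "g x = ereal (r x)"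
      by (cases "g x") (auto simp: r_def)
  qed
  with g have r: "convex_on UNIV r" "\<And>x. p x \<le> r x" "\<And>x. r x \<le> q x"
    by (auto simp: convex_majorant_def ereal_convex_real_iff)
  obtain h where h: "sublinear_fun h" "\<And>x. p x \<le> h x" "\<And>x. h x \<le> r x"
    using sublinear_hull[OF r(1) hom r(2)] by blast
  have "h = q"
    using h r(3) by (intro min) (auto simp: le_fun_def intro: order_trans)
  with h(3) r(3) have "r = q"
    by (auto intro: antisym)
  then show "g = (\<lambda>x. ereal (q x))"
    by (simp add: g_eq)
qed

section \<open>Sublinear majorants from upper semicontinuity\<close>

text \<open>Upper semicontinuity at 0 bounds \<open>p\<close> by 1 on a ball, and scaling spreads
  this bound to the whole space.\<close>

lemma homogeneous_usc_linear_bound: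
  fixes p :: "'a::real_normed_vector \<Rightarrow> real"
  assumes hom: "\<And>x t. t > 0 \<Longrightarrow> p (t *\<^sub>R x) = t * p x"
    and usc: "upper_semicontinuous p"
  obtains K where "K > 0" "\<And>x. p x \<le> K * norm x"
proof -
  have p0: "p 0 = 0"
    using hom[of 2 0] by simp
  then have "\<forall>\<^sub>F y in nhds 0. p y < 1"
    using usc by (simp add: upper_semicontinuous_def)
  then obtain d where d: "d > 0" "\<And>y. norm y < d \<Longrightarrow> p y < 1"
    by (auto simp: eventually_nhds_metric)
  show ?thesis
  proof
    show "2 / d > 0" using d by simp
    show "p x \<le> 2 / d * norm x" for x
    proof (cases "x = 0")
      case False
      \<comment> \<open>This factor brings \<open>x\<close> to norm \<open>d / 2\<close>, safely
        inside the open ball.\<close>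
      define t where "t = d / (2 * norm x)"
      have t: "t > 0" using False d by (simp add: t_def)
      have "norm (t *\<^sub>R x) < d" using False d by (simp add: t_def)
      then have "t * p x < 1" using d(2) hom[OF t, of x] by metis
      then show ?thesis
        using False d by (simp add: t_def field_simps)
    qed (simp add: p0)
  qed
qed

text \<open>The function constructed is the largest sublinear one that is at most \<open>c\<close>
  at \<open>x0\<close> and at most \<open>M * norm x\<close> everywhere.\<close>

lemma usc_sublinear_majorant:
  fixes p :: "'a::real_normed_vector \<Rightarrow> real"
  assumes hom: "\<And>x t. t > 0 \<Longrightarrow> p (t *\<^sub>R x) = t * p x"
    and usc: "upper_semicontinuous p" and c: "p x0 < c"
  obtains \<phi> M where "sublinear_fun \<phi>" "p \<le> \<phi>" "\<phi> x0 \<le> c" "\<And>x. \<phi> x \<le> M * norm x"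
proof -
  obtain K where K: "K > 0" "\<And>x. p x \<le> K * norm x"
    using homogeneous_usc_linear_bound[OF hom usc] by blast
  have "\<forall>\<^sub>F y in nhds x0. p y < c"
    using usc c by (simp add: upper_semicontinuous_def)
  then obtain d where d: "d > 0" "\<And>y. norm (y - x0) < d \<Longrightarrow> p y < c"
    by (auto simp: eventually_nhds_metric dist_norm)
  \<comment> \<open>At distance at least \<open>d\<close> from \<open>x0\<close>, the slope
    \<open>L\<close> pays for \<open>K * norm x0\<close> and for a possibly negative
    \<open>c\<close>, while \<open>K\<close> pays for \<open>norm (y - x0)\<close>.\<close>
  define L where "L = (K * norm x0 + \<bar>c\<bar>) / d"
  define M where "M = K + L"
  have L: "L \<ge> 0" using K d by (simp add: L_def)
  have M: "M \<ge> K" "M \<ge> 0" using K L by (auto simp: M_def)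
  have near: "p y \<le> c + M * norm (y - x0)" for y
  proof (cases "norm (y - x0) < d")
    case True
    then show ?thesis using d(2)[of y] M by (smt (verit) mult_nonneg_nonneg norm_ge_zero)
  next
    case False
    have "K * norm y \<le> K * (norm (y - x0) + norm x0)"
      using K norm_triangle_sub[of y x0] by (intro mult_left_mono) auto
    moreover have "L * d \<le> L * norm (y - x0)"
      using False L by (intro mult_left_mono) auto
    moreover have "L * d = K * norm x0 + \<bar>c\<bar>"
      using d by (simp add: L_def)
    ultimately show ?thesis
      using K(2)[of y] by (simp add: M_def algebra_simps)
  qed
  define f where "f = (\<lambda>x t. t * c + M * norm (x - t *\<^sub>R x0))"
  have f_ge: "p x \<le> f x t" if "t \<ge> 0" for x t
  proof (cases "t = 0")
    \<comment> \<open>Rescaling by \<open>t\<close> is impossible here; the global bound with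
      \<open>K \<le> M\<close> takes its place. For positive \<open>t\<close> the estimate
      \<open>near\<close> is applied at \<open>x /\<^sub>R t\<close>.\<close>
    case True
    then show ?thesis
      using K(2)[of x] M mult_right_mono[of K M "norm x"] by (simp add: f_def)
  next
    case False
    with that have t: "t > 0" by simp
    have "p x = t * p (x /\<^sub>R t)"
      using hom[OF t, of "x /\<^sub>R t"] t by simp
    also have "\<dots> \<le> t * (c + M * norm (x /\<^sub>R t - x0))"
      using near t by (intro mult_left_mono) auto
    also have "\<dots> = t * c + M * norm (t *\<^sub>R (x /\<^sub>R t - x0))"
      using t by (simp add: distrib_left)
    also have "t *\<^sub>R (x /\<^sub>R t - x0) = x - t *\<^sub>R x0"
      using t by (simp add: scaleR_right_diff_distrib)
    finally show ?thesis by (simp add: f_def)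
  qed
  define \<phi> where "\<phi> = (\<lambda>x. INF t\<in>{0..}. f x t)"
  have \<phi>_le: "\<phi> x \<le> f x t" if "t \<ge> 0" for x t
    unfolding \<phi>_def using that f_ge
    by (intro cINF_lower) (auto intro!: bdd_belowI2[where m = "p x"])
  have \<phi>_ge: "z \<le> \<phi> x" if "\<And>t. t \<ge> 0 \<Longrightarrow> z \<le> f x t" for z x
    unfolding \<phi>_def using that by (intro cINF_greatest) auto
  show ?thesis
  proof
    show "p \<le> \<phi>"
      using f_ge by (auto simp: le_fun_def intro: \<phi>_ge)
    show "\<phi> x0 \<le> c"
      using \<phi>_le[of 1 x0] by (simp add: f_def)
    show "\<phi> x \<le> M * norm x" for x
      using \<phi>_le[of 0 x] by (simp add: f_def)
    show "sublinear_fun \<phi>"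
    proof (rule sublinear_funI)
      fix x y
      have *: "\<phi> (x + y) \<le> f x s + f y t" if "s \<ge> 0" "t \<ge> 0" for s t
      proof -
        \<comment> \<open>Subadditivity holds because the parameters add: \<open>s\<close> for
          \<open>x\<close> and \<open>t\<close> for \<open>y\<close> give the admissible choice
          \<open>s + t\<close> for \<open>x + y\<close>.\<close>
        have "norm (x + y - (s + t) *\<^sub>R x0) \<le> norm (x - s *\<^sub>R x0) + norm (y - t *\<^sub>R x0)"
          using norm_triangle_ineq[of "x - s *\<^sub>R x0" "y - t *\<^sub>R x0"] by (simp add: algebra_simps)
        then have "M * norm (x + y - (s + t) *\<^sub>R x0)
            \<le> M * (norm (x - s *\<^sub>R x0) + norm (y - t *\<^sub>R x0))"
          using M by (intro mult_left_mono) auto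
        then have "f (x + y) (s + t) \<le> f x s + f y t"
          by (simp add: f_def distrib_left distrib_right)
        then show ?thesis
          using \<phi>_le[of "s + t" "x + y"] that by simp
      qed
      have "\<phi> (x + y) - f x s \<le> \<phi> y" if "s \<ge> 0" for s
        using *[OF that] by (intro \<phi>_ge) (simp add: algebra_simps)
      then have "\<phi> (x + y) - \<phi> y \<le> \<phi> x"
        by (intro \<phi>_ge) (smt (verit))
      then show "\<phi> (x + y) \<le> \<phi> x + \<phi> y" by simp
    next
      fix x and t :: real
      assume t: "t > 0"
      have "\<phi> (t *\<^sub>R x) / t \<le> \<phi> x"
      proof (rule \<phi>_ge)
        fix s :: real assume "s \<ge> 0"
        have "norm (t *\<^sub>R x - (t * s) *\<^sub>R x0) = t * norm (x - s *\<^sub>R x0)"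
          using t by (metis abs_of_pos norm_scaleR scaleR_right_diff_distrib scaleR_scaleR)
        then have "f (t *\<^sub>R x) (t * s) = t * f x s"
          by (simp add: f_def algebra_simps)
        then show "\<phi> (t *\<^sub>R x) / t \<le> f x s"
          using \<phi>_le[of "t * s" "t *\<^sub>R x"] t \<open>s \<ge> 0\<close> by (simp add: field_simps)
      qed
      then show "\<phi> (t *\<^sub>R x) \<le> t * \<phi> x"
        using t by (simp add: field_simps)
    qed
  qed
qed

section \<open>Representation as an infimum\<close>

text \<open>A minimal sublinear majorant below \<open>\<phi>\<close> inherits both the value bound
  at \<open>x0\<close> and the bound \<open>M * norm x\<close>, and the latter makes it
  continuous.\<close>

lemma S_C_plus_approx:
  fixes p :: "'a::real_normed_vector \<Rightarrow> real"
  assumes hom: "\<And>x t. t > 0 \<Longrightarrow> p (t *\<^sub>R x) = t * p x"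
    and usc: "upper_semicontinuous p" and c: "p x0 < c"
  obtains q where "q \<in> S_C_plus (\<lambda>x. ereal (p x))" "q x0 \<le> c"
proof -
  obtain \<phi> M where \<phi>: "sublinear_fun \<phi>" "p \<le> \<phi>" "\<phi> x0 \<le> c" "\<And>x. \<phi> x \<le> M * norm x"
    using usc_sublinear_majorant[OF assms] by blast
  obtain q where q: "sublinear_fun q" "p \<le> q" "q \<le> \<phi>"
    "\<And>q'. sublinear_fun q' \<Longrightarrow> p \<le> q' \<Longrightarrow> q' \<le> q \<Longrightarrow> q' = q"
    using minimal_sublinear_majorant[OF \<phi>(1,2)] by blast
  have "q x \<le> M * norm x" for x
    using q(3) \<phi>(4)[of x] by (auto simp: le_fun_def intro: order_trans)
  then have "continuous_on UNIV q"
    using q(1) by (rule sublinear_fun_continuous_on[rotated])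
  with q have "q \<in> S_C_plus (\<lambda>x. ereal (p x))"
    by (simp add: S_C_plus_def sublinear_fun_imp_sublinear
        minimal_convex_majorant_if_minimal_sublinear[OF hom])
  moreover have "q x0 \<le> c"
    using q(3) \<phi>(3) by (auto simp: le_fun_def intro: order_trans)
  ultimately show ?thesis
    using that by blast
qed

lemma S_C_plus_ge: "\<phi> \<in> S_C_plus (\<lambda>x. ereal (p x)) \<Longrightarrow> p x \<le> \<phi> x"
  by (simp add: S_C_plus_def minimal_convex_majorant_def convex_majorant_def)

lemma usc_iff_INF_S_C_plus:
  fixes p :: "'a::real_normed_vector \<Rightarrow> real"
  assumes "pos_homogeneous (\<lambda>x. ereal (p x))"
  shows "upper_semicontinuous p \<longleftrightarrow>
            S_C_plus (\<lambda>x. ereal (p x)) \<noteq> {} \<and>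
            (\<forall>x. ereal (p x) = (INF \<phi>\<in>S_C_plus (\<lambda>x. ereal (p x)). ereal (\<phi> x)))"
    (is "_ \<longleftrightarrow> ?S \<noteq> {} \<and> _")
proof (intro iffI conjI allI; (elim conjE)?)
  have hom: "\<And>x t. t > 0 \<Longrightarrow> p (t *\<^sub>R x) = t * p x"
    using assms by (simp add: pos_homogeneous_real_iff)
  assume usc: "upper_semicontinuous p"
  show "?S \<noteq> {}"
    \<comment> \<open>Any point and any level above the value of \<open>p\<close> there would
      do.\<close>
    using S_C_plus_approx[OF hom usc, of undefined "p undefined + 1"] by force
  show "ereal (p x) = (INF \<phi>\<in>?S. ereal (\<phi> x))" for x
  proof (rule antisym)
    show "ereal (p x) \<le> (INF \<phi>\<in>?S. ereal (\<phi> x))"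
      by (intro INF_greatest) (simp add: S_C_plus_ge)
    show "(INF \<phi>\<in>?S. ereal (\<phi> x)) \<le> ereal (p x)"
    proof (rule ereal_le_epsilon2)
      fix e :: real
      assume "0 < e"
      then obtain q where "q \<in> ?S" "q x \<le> p x + e"
        using S_C_plus_approx[OF hom usc, of x "p x + e"] by force
      then show "(INF \<phi>\<in>?S. ereal (\<phi> x)) \<le> ereal (p x) + ereal e"
        by (auto intro: INF_lower2)
    qed
  qed
next
  assume eq: "\<forall>x. ereal (p x) = (INF \<phi>\<in>?S. ereal (\<phi> x))"
  show "upper_semicontinuous p"
    unfolding upper_semicontinuous_def
  proof (intro allI impI)
    fix x c
    assume "p x < c"
    then have "(INF \<phi>\<in>?S. ereal (\<phi> x)) < ereal c"
      using eq by (metis less_ereal.simps(1))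
    \<comment> \<open>One member below \<open>c\<close> at \<open>x\<close> is enough: by continuity
      it stays below \<open>c\<close> near \<open>x\<close>, and it dominates
      \<open>p\<close>.\<close>
    then obtain \<phi> where \<phi>: "\<phi> \<in> ?S" "\<phi> x < c"
      by (auto simp: INF_less_iff)
    then have "isCont \<phi> x"
      by (simp add: S_C_plus_def continuous_on_eq_continuous_at)
    then have "\<forall>\<^sub>F y in nhds x. \<phi> y < c"
      using \<phi>(2) by (simp add: continuous_at tendsto_at_iff_tendsto_nhds order_tendstoD(2))
    then show "\<forall>\<^sub>F y in nhds x. p y < c"
      by eventually_elim (use S_C_plus_ge[OF \<phi>(1)] in \<open>metis le_less_trans\<close>)
  qed
qed

section \<open>Duality under negation\<close>

lemma pos_homogeneous_uminus_iff:
  "pos_homogeneous (\<lambda>x. - g x) \<longleftrightarrow> pos_homogeneous g"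
  by (simp add: pos_homogeneous_def)

lemma upper_semicontinuous_uminus_iff:
  fixes p :: "'a::topological_space \<Rightarrow> real"
  shows "upper_semicontinuous (\<lambda>x. - p x) \<longleftrightarrow> lower_semicontinuous p"
proof -
  have "(\<forall>c. - p x < c \<longrightarrow> (\<forall>\<^sub>F y in nhds x. - p y < c)) \<longleftrightarrow>
      (\<forall>c. c < p x \<longrightarrow> (\<forall>\<^sub>F y in nhds x. c < p y))" (is "?l \<longleftrightarrow> ?r") for x
  proof
    assume l: ?l
    show ?r
      using l[rule_format, of "- _"] by simp
  next
    assume ?r
    then show ?l by (simp add: minus_less_iff)
  qed
  then show ?thesis
    unfolding upper_semicontinuous_def lower_semicontinuous_def by simp
qed

lemma convex_majorant_uminus_iff:
  "convex_majorant (\<lambda>x. - p x) (\<lambda>x. - h x) \<longleftrightarrow> concave_minorant p h"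
  by (simp add: convex_majorant_def concave_minorant_def ereal_concave_def)

text \<open>Negation is an order-reversing bijection between concave minorants of \<open>p\<close>
  and convex majorants of its negative.\<close>

lemma minimal_convex_majorant_uminus_iff:
  "minimal_convex_majorant (\<lambda>x. - p x) (\<lambda>x. - h x) \<longleftrightarrow> maximal_concave_minorant p h"
proof -
  \<comment> \<open>Every function is the negative of some function, so the quantifier over
    competitors can be reindexed by negation.\<close>
  have all_uminus: "(\<forall>g. P g) \<longleftrightarrow> (\<forall>h. P (\<lambda>x. - h x))" for P :: "('a \<Rightarrow> ereal) \<Rightarrow> bool"
  proof
    assume *: "\<forall>h. P (\<lambda>x. - h x)"
    show "\<forall>g. P g"
    proof
      fix g show "P g" using *[rule_format, of "\<lambda>x. - g x"] by simp
    qed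
  qed simp
  show ?thesis
    unfolding minimal_convex_majorant_def maximal_concave_minorant_def
    by (subst all_uminus) (simp add: convex_majorant_uminus_iff fun_eq_iff)
qed

lemma S_C_plus_uminus_iff:
  "(\<lambda>x. - \<psi> x) \<in> S_C_plus (\<lambda>x. ereal (- p x)) \<longleftrightarrow> \<psi> \<in> S_C_minus (\<lambda>x. ereal (p x))"
proof -
  have "minimal_convex_majorant (\<lambda>x. ereal (- p x)) (\<lambda>x. ereal (- \<psi> x)) \<longleftrightarrow>
      maximal_concave_minorant (\<lambda>x. ereal (p x)) (\<lambda>x. ereal (\<psi> x))"
    using minimal_convex_majorant_uminus_iff[of "\<lambda>x. ereal (p x)" "\<lambda>x. ereal (\<psi> x)"] by simp
  moreover have "sublinear (\<lambda>x. ereal (- \<psi> x)) \<longleftrightarrow> superlinear (\<lambda>x. ereal (\<psi> x))"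
    using pos_homogeneous_uminus_iff[of "\<lambda>x. ereal (\<psi> x)"]
    by (simp add: sublinear_def superlinear_def ereal_concave_def)
  moreover have "continuous_on UNIV (\<lambda>x. - \<psi> x) \<longleftrightarrow> continuous_on UNIV \<psi>"
    using continuous_on_minus[of UNIV \<psi>] continuous_on_minus[of UNIV "\<lambda>x. - \<psi> x"] by auto
  ultimately show ?thesis
    by (simp add: S_C_plus_def S_C_minus_def)
qed

text \<open>Stated as an image so that the infimum over the left side can be rewritten as a negated
  supremum.\<close>

lemma S_C_plus_uminus:
  "S_C_plus (\<lambda>x. ereal (- p x)) = (\<lambda>\<psi> x. - \<psi> x) ` S_C_minus (\<lambda>x. ereal (p x))"
proof (intro equalityI subsetI)
  fix \<phi>
  assume "\<phi> \<in> S_C_plus (\<lambda>x. ereal (- p x))"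
  then have "(\<lambda>x. - \<phi> x) \<in> S_C_minus (\<lambda>x. ereal (p x))"
    using S_C_plus_uminus_iff[of "\<lambda>x. - \<phi> x"] by simp
  then show "\<phi> \<in> (\<lambda>\<psi> x. - \<psi> x) ` S_C_minus (\<lambda>x. ereal (p x))"
    by (rule rev_image_eqI) simp
qed (auto simp: S_C_plus_uminus_iff)

lemma lsc_iff_SUP_S_C_minus:
  fixes p :: "'a::real_normed_vector \<Rightarrow> real"
  assumes "pos_homogeneous (\<lambda>x. ereal (p x))"
  shows "lower_semicontinuous p \<longleftrightarrow>
            S_C_minus (\<lambda>x. ereal (p x)) \<noteq> {} \<and>
            (\<forall>x. ereal (p x) = (SUP \<psi>\<in>S_C_minus (\<lambda>x. ereal (p x)). ereal (\<psi> x)))"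
    (is "_ \<longleftrightarrow> ?S \<noteq> {} \<and> _")
proof -
  have "pos_homogeneous (\<lambda>x. ereal (- p x))"
    using assms pos_homogeneous_uminus_iff[of "\<lambda>x. ereal (p x)"] by simp
  note usc_iff_INF_S_C_plus[OF this, unfolded upper_semicontinuous_uminus_iff S_C_plus_uminus]
  moreover have "(INF \<phi>\<in>(\<lambda>\<psi> x. - \<psi> x) ` ?S. ereal (\<phi> x)) = - (SUP \<psi>\<in>?S. ereal (\<psi> x))" for x
    using ereal_INF_uminus_eq[of "\<lambda>\<psi>. ereal (\<psi> x)" ?S] by (simp add: image_image)
  \<comment> \<open>Cancels the sign that turning the infimum into a supremum leaves on both sides
    of the representation.\<close>
  moreover have "ereal (- p x) = - s \<longleftrightarrow> ereal (p x) = s" for x s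
    by (metis ereal_uminus_eq_iff uminus_ereal.simps(1))
  ultimately show ?thesis
    by simp
qed

theorem theorem4p9:
  fixes p :: "'a::real_normed_vector \<Rightarrow> real"
  assumes "pos_homogeneous (\<lambda>x. ereal (p x))"
  shows "(upper_semicontinuous p \<longleftrightarrow>
            S_C_plus (\<lambda>x. ereal (p x)) \<noteq> {} \<and>
            (\<forall>x. ereal (p x) = (INF \<phi>\<in>S_C_plus (\<lambda>x. ereal (p x)). ereal (\<phi> x)))) \<and>
         (lower_semicontinuous p \<longleftrightarrow>
            S_C_minus (\<lambda>x. ereal (p x)) \<noteq> {} \<and>
            (\<forall>x. ereal (p x) = (SUP \<psi>\<in>S_C_minus (\<lambda>x. ereal (p x)). ereal (\<psi> x))))"
  using usc_iff_INF_S_C_plus[OF assms] lsc_iff_SUP_S_C_minus[OF assms] by (rule conjI)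

end
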